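(* Let $F=(F_1,\dots,F_m)^\top:\mathbb{R}^n\to\mathbb{R}^m$ be continuously differentiable and let $x^0\in\mathbb{R}^n$. Let $\mathcal{L}=\{x\in\mathbb{R}^n: F_i(x)\le F_i(x^0)\ \text{for all } i\in\{1,\dots,m\}\}$. Assume: (A1) $F$ is bounded below on $\mathcal{L}$ (i.e. each $F_i$ is bounded below on $\mathcal{L}$); (A2) there are an open set $\mathcal{B}\supseteq\mathcal{L}$ and constants $L_i>0$ such that $\|\nabla F_i(x)-\nabla F_i(y)\|\le L_i\|x-y\|$ for all $x,y\in\mathcal{B}$ and $i\in\{1,\dots,m\}$. Let $\{x^k\}$ be the (infinite) sequence produced from $x^0$ by the MSD-I algorithm, with associated parameters $\tau_k>0$, and assume: (A3) there is a real number $b>0$ such that $\tau_k\le b$ for all $k$. Then every limit point (accumulation point) of $\{x^k\}$ is a Pareto critical point of $F$.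
   Context: A point $\bar x\in\mathbb{R}^n$ is Pareto critical for $F$ if there is no $d\in\mathbb{R}^n$ with $\langle\nabla F_i(\bar x),d\rangle<0$ for all $i\in\{1,\dots,m\}$. $\|\cdot\|$ and $\langle\cdot,\cdot\rangle$ are the Euclidean norm and inner product. For $x,d\in\mathbb{R}^n$ let $\psi(x,d)=\max_{1\le i\le m}\langle\nabla F_i(x),d\rangle$. The steepest descent direction $v(x)$ is the unique minimizer over $d\in\mathbb{R}^n$ of $\psi(x,d)+\tfrac12\|d\|^2$; equivalently $v(x)=-\sum_{i=1}^m\lambda_i(x)\nabla F_i(x)$, where $\lambda(x)$ is an optimal solution of $\min\{\tfrac12\|\sum_{i=1}^m\lambda_i\nabla F_i(x)\|^2:\ \lambda\in\mathbb{R}^m,\ \lambda_i\ge0,\ \sum_i\lambda_i=1\}$. MSD-I algorithm. Fix $\rho,\delta\in(0,1)$, an initial point $x^0\in\mathbb{R}^n$ and $\tau_0=1$. For $k=0,1,2,\dots$: 1. Compute an optimal solution $\lambda^k=\lambda(x^k)$ of $\min\{\tfrac12\|\sum_{i=1}^m\lambda_i\nabla F_i(x^k)\|^2:\ \lambda\in\mathbb{R}^m,\ \lambda_i\ge0,\ \sum_i\lambda_i=1\}$, and $v(x^k)=-\sum_i\lambda_i^k\nabla F_i(x^k)$. If $v(x^k)=0$, stop. 2. Set $d^k=\tau_k^{-1}v(x^k)$ and let $t_k$ be the largest value in $\{\delta^0,\delta^1,\delta^2,\dots\}$ such that $F_i(x^k+t_kd^k)\le F_i(x^k)+\rho\, t_k\,\psi(x^k,d^k)$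 for all $i\in\{1,\dots,m\}$. 3. Set $x^{k+1}=x^k+t_kd^k$. 4. Set $$\tau_{k+1}=\frac{2\tau_k\left(\tau_k\sum_{i=1}^m\lambda_i^k\,(F_i(x^{k+1})-F_i(x^k))+t_k\|v(x^k)\|^2\right)}{t_k^2\|v(x^k)\|^2};$$ if this value is negative, replace it by $\tau_{k+1}=1$. Standing convention: $\tau_k>0$ for all $k$, so that the algorithm is well defined. The algorithm is assumed not to stop, so that the sequence is infinite. *)

theory Defs
  imports "HOL-Analysis.Analysis"
begin

definition grad :: "('a::real_inner \<Rightarrow> real) \<Rightarrow> 'a \<Rightarrow> 'a" where
  "grad f x = (THE D. GDERIV f x :> D)"

definition continuously_differentiable ::
    "('a::real_normed_vector \<Rightarrow> 'b::real_normed_vector) \<Rightarrow> bool" where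
  "continuously_differentiable f \<longleftrightarrow>
    (\<exists>f' :: 'a \<Rightarrow> 'a \<Rightarrow>\<^sub>L 'b.
       (\<forall>x. (f has_derivative blinfun_apply (f' x)) (at x)) \<and> continuous_on UNIV f')"

abbreviation grad_comp :: "(real^'n \<Rightarrow> real^'m) \<Rightarrow> 'm \<Rightarrow> real^'n \<Rightarrow> real^'n" where
  "grad_comp F i \<equiv> grad (\<lambda>y. F y $ i)"

definition Pareto_critical :: "(real^'n \<Rightarrow> real^'m) \<Rightarrow> real^'n \<Rightarrow> bool" where
  "Pareto_critical F x \<longleftrightarrow> \<not> (\<exists>d. \<forall>i. grad_comp F i x \<bullet> d < 0)"

definition level_set :: "(real^'n \<Rightarrow> real^'m) \<Rightarrow> real^'n \<Rightarrow> (real^'n) set" where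
  "level_set F x0 = {x. \<forall>i. F x $ i \<le> F x0 $ i}"

definition psi :: "(real^'n \<Rightarrow> real^'m) \<Rightarrow> real^'n \<Rightarrow> real^'n \<Rightarrow> real" where
  "psi F x d = (MAX i. grad_comp F i x \<bullet> d)"

definition unit_simplex :: "(real^'m) set" where
  "unit_simplex = {l. (\<forall>i. 0 \<le> l $ i) \<and> (\<Sum>i\<in>UNIV. l $ i) = 1}"

definition grad_comb :: "(real^'n \<Rightarrow> real^'m) \<Rightarrow> real^'n \<Rightarrow> real^'m \<Rightarrow> real^'n" where
  "grad_comb F x l = (\<Sum>i\<in>UNIV. (l $ i) *\<^sub>R grad_comp F i x)"

definition dual_solution :: "(real^'n \<Rightarrow> real^'m) \<Rightarrow> real^'n \<Rightarrow> real^'m \<Rightarrow> bool" where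
  "dual_solution F x l \<longleftrightarrow>
    is_arg_min (\<lambda>l. 1/2 * (norm (grad_comb F x l))\<^sup>2) (\<lambda>l. l \<in> unit_simplex) l"

definition armijo_steps ::
    "(real^'n \<Rightarrow> real^'m) \<Rightarrow> real \<Rightarrow> real \<Rightarrow> real^'n \<Rightarrow> real^'n \<Rightarrow> real set" where
  "armijo_steps F \<rho> \<delta> x d =
    {s \<in> range (\<lambda>j::nat. \<delta> ^ j).
       \<forall>i. F (x + s *\<^sub>R d) $ i \<le> F x $ i + \<rho> * s * psi F x d}"

definition tau_update ::
    "(real^'n \<Rightarrow> real^'m) \<Rightarrow> real \<Rightarrow> real^'m \<Rightarrow> real^'n \<Rightarrow> real^'n \<Rightarrow> real^'n \<Rightarrow> real \<Rightarrow> real" where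
  "tau_update F \<tau> l v x x' t =
    (let r = 2 * \<tau> * (\<tau> * (\<Sum>i\<in>UNIV. l $ i * (F x' $ i - F x $ i)) + t * (norm v)\<^sup>2)
               / (t\<^sup>2 * (norm v)\<^sup>2)
     in if r < 0 then 1 else r)"

text \<open>
  The iteration is a relation rather than a function because the dual solution chosen in each step
  need not be unique. The condition \<open>v \<noteq> 0\<close> says that the stopping test never succeeds.
\<close>

definition MSD_I ::
    "(real^'n \<Rightarrow> real^'m) \<Rightarrow> real \<Rightarrow> real \<Rightarrow> real^'n \<Rightarrow>
     (nat \<Rightarrow> real^'n) \<Rightarrow> (nat \<Rightarrow> real^'m) \<Rightarrow> (nat \<Rightarrow> real) \<Rightarrow> (nat \<Rightarrow> real) \<Rightarrow> bool" where
  "MSD_I F \<rho> \<delta> x0 x lam t \<tau> \<longleftrightarrow>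
    x 0 = x0 \<and> \<tau> 0 = 1 \<and>
    (\<forall>k. let v = - grad_comb F (x k) (lam k);
             d = inverse (\<tau> k) *\<^sub>R v;
             S = armijo_steps F \<rho> \<delta> (x k) d
         in dual_solution F (x k) (lam k) \<and>
            v \<noteq> 0 \<and>
            t k \<in> S \<and> (\<forall>s\<in>S. s \<le> t k) \<and>
            x (Suc k) = x k + t k *\<^sub>R d \<and>
            \<tau> (Suc k) = tau_update F (\<tau> k) (lam k) v (x k) (x (Suc k)) (t k))"

definition seq_limit_point :: "(nat \<Rightarrow> 'a::topological_space) \<Rightarrow> 'a \<Rightarrow> bool" where
  "seq_limit_point x p \<longleftrightarrow> (\<exists>r. strict_mono r \<and> (x \<circ> r) \<longlonglongrightarrow> p)"

end

(*
  Only the effective step sizes s = t / tau matter. Suppose the iterates converge to p along a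
  subsequence and p is not Pareto critical. A common descent direction at p keeps the norms of
  v(x^k) away from 0 along the subsequence, while the Armijo decrease, which is at least
  rho * s * |v|^2, tends to 0. So s and s * v tend to 0. Since 1 / tau \<ge> 1 / b, the unit step t = 1
  is eventually rejected, and by the mean value theorem the rejected trial step t / delta exhibits
  two points near p whose gradients differ by more than (1 - rho) * |v|, against the continuity of
  the gradients at p.
*)
theory Submission
  imports Defs
begin

section \<open>Gradients of the components and a mean value theorem\<close>

lemma grad_eqI:
  assumes "GDERIV f x :> D"
  shows "grad f x = D"
  unfolding grad_def
proof (rule the_equality)
  fix D' assume "GDERIV f x :> D'"
  with assms have "(\<lambda>h. h \<bullet> D') = (\<lambda>h. h \<bullet> D)"
    unfolding gderiv_def by (rule has_derivative_unique[rotated])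
  then have "(D' - D) \<bullet> D' = (D' - D) \<bullet> D"
    by metis
  then have "(D' - D) \<bullet> (D' - D) = 0"
    by (simp add: inner_diff_right)
  then show "D' = D" by simp
qed (fact assms)

text \<open>Row \<open>i\<close> of the Jacobian represents the derivative of component
  \<open>i\<close>, and its entries are values of \<open>f'\<close> at basis vectors, hence
  continuous in the base point. \<open>grad_eqI\<close> identifies this row with the definite
  description \<open>grad\<close>.\<close>

lemma continuously_differentiable_grad_comp:
  fixes F :: "real^'n \<Rightarrow> real^'m"
  assumes "continuously_differentiable F"
  shows "GDERIV (\<lambda>y. F y $ i) x :> grad_comp F i x"
    and "continuous_on UNIV (grad_comp F i)"
proof -
  obtain f' :: "real^'n \<Rightarrow> (real^'n) \<Rightarrow>\<^sub>L (real^'m)"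
    where f': "\<And>x. (F has_derivative blinfun_apply (f' x)) (at x)" and cont: "continuous_on UNIV f'"
    using assms unfolding continuously_differentiable_def by blast
  define G where "G x = (\<chi> j. blinfun_apply (f' x) (axis j 1) $ i)" for x
  have inner_G: "blinfun_apply (f' x) h $ i = h \<bullet> G x" for x h
  proof -
    have "blinfun_apply (f' x) h = blinfun_apply (f' x) (\<Sum>j\<in>UNIV. h $ j *\<^sub>R axis j 1)"
      using basis_expansion[of h] by (simp add: scalar_mult_eq_scaleR)
    also have "\<dots> = (\<Sum>j\<in>UNIV. h $ j *\<^sub>R blinfun_apply (f' x) (axis j 1))"
      by (simp add: blinfun.sum_right blinfun.scaleR_right)
    finally show ?thesis
      by (simp add: G_def inner_vec_def)
  qed
  have G: "GDERIV (\<lambda>y. F y $ i) x :> G x" for x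
    unfolding gderiv_def inner_G[symmetric]
    by (rule bounded_linear.has_derivative[OF bounded_linear_vec_nth f'])
  have grad: "grad_comp F i = G"
    using grad_eqI[OF G] by auto
  show "GDERIV (\<lambda>y. F y $ i) x :> grad_comp F i x"
    using G grad by simp
  show "continuous_on UNIV (grad_comp F i)"
    unfolding grad G_def by (intro continuous_intros cont)
qed

lemma gderiv_mvt:
  fixes f :: "'a::real_inner \<Rightarrow> real"
  assumes "\<And>y. GDERIV f y :> g y"
  obtains \<xi> where "\<xi> \<in> closed_segment x (x + h)" "f (x + h) - f x = g \<xi> \<bullet> h"
proof -
  have "((\<lambda>u. f (x + u *\<^sub>R h)) has_derivative (\<lambda>k. (k *\<^sub>R h) \<bullet> g (x + u *\<^sub>R h))) (at u)" for u :: real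
  proof -
    have "((\<lambda>u. x + u *\<^sub>R h) has_derivative (\<lambda>k. k *\<^sub>R h)) (at u)"
      by (auto intro!: derivative_eq_intros)
    from has_derivative_compose[OF this assms[unfolded gderiv_def]] show ?thesis .
  qed
  from mvt_simple[OF zero_less_one has_derivative_at_withinI[OF this]]
  obtain u :: real where u: "u \<in> {0<..<1}"
    "f (x + 1 *\<^sub>R h) - f (x + 0 *\<^sub>R h) = ((1 - 0) *\<^sub>R h) \<bullet> g (x + u *\<^sub>R h)"
    by blast
  show ?thesis
  proof
    show "x + u *\<^sub>R h \<in> closed_segment x (x + h)"
      using u(1) by (auto simp: closed_segment_def algebra_simps intro!: exI[of _ u])
    show "f (x + h) - f x = g (x + u *\<^sub>R h) \<bullet> h"
      using u(2) by (simp add: inner_commute)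
  qed
qed

section \<open>Steepest descent direction, criticality and line search\<close>

lemma grad_comp_le_psi: "grad_comp F i x \<bullet> d \<le> psi F x d"
  unfolding psi_def by (rule Max_ge) auto

lemma psi_leI:
  assumes "\<And>i. grad_comp F i x \<bullet> d \<le> c"
  shows "psi F x d \<le> c"
  unfolding psi_def using assms by (subst Max_le_iff) auto

text \<open>This is the variational inequality for the point of least norm in the convex hull of the
  gradients: if it failed for gradient \<open>i\<close>, a short move towards that gradient would
  shorten the vector.\<close>

lemma dual_solution_inner_ge:
  assumes "dual_solution F x l"
  shows "(norm (grad_comb F x l))\<^sup>2 \<le> grad_comp F i x \<bullet> grad_comb F x l"
proof (rule ccontr)
  let ?w = "grad_comb F x l" and ?g = "grad_comp F i x"
  assume "\<not> ?thesis"
  then have "(0 - ?w) \<bullet> (?g - ?w) > 0"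
    by (simp add: inner_diff_right power2_norm_eq_inner inner_commute)
  from closer_point_lemma[OF this] obtain u
    where u: "0 < u" "u \<le> 1" "norm (?w + u *\<^sub>R (?g - ?w)) < norm ?w"
    by (auto simp: dist_norm)
  \<comment> \<open>Moving the weights towards vertex \<open>i\<close> of the simplex realizes the
    shorter vector as a feasible combination.\<close>
  define l' where "l' = (1 - u) *\<^sub>R l + u *\<^sub>R axis i 1"
  have l: "l \<in> unit_simplex"
    and min: "\<And>k. k \<in> unit_simplex \<Longrightarrow> norm ?w \<le> norm (grad_comb F x k)"
    using assms by (auto simp: dual_solution_def is_arg_min_linorder)
  have "l' \<in> unit_simplex"
    using l u(1,2)
    by (auto simp: unit_simplex_def l'_def sum.distrib axis_def simp flip: sum_distrib_left)
  moreover have "grad_comb F x l' = ?w + u *\<^sub>R (?g - ?w)"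
  proof -
    have "grad_comb F x (axis i 1) = ?g"
      by (simp add: grad_comb_def axis_def if_distrib[of "\<lambda>c. c *\<^sub>R _"] cong: if_cong)
    moreover have "grad_comb F x l' = (1 - u) *\<^sub>R ?w + u *\<^sub>R grad_comb F x (axis i 1)"
      by (simp add: grad_comb_def l'_def scaleR_left_distrib sum.distrib scaleR_sum_right)
    ultimately show ?thesis
      by (simp add: algebra_simps)
  qed
  ultimately show False
    using min[of l'] u(3) by simp
qed

text \<open>The variational inequality holds for every \<open>i\<close>, so it survives the maximum.
  With \<open>c = inverse (\<tau> k)\<close> the argument of \<open>psi\<close> is the search
  direction of step \<open>k\<close>.\<close>

lemma psi_descent_le:
  assumes "dual_solution F x l" "0 \<le> c"
  shows "psi F x (c *\<^sub>R (- grad_comb F x l)) \<le> - (c * (norm (grad_comb F x l))\<^sup>2)"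
  using mult_left_mono[OF dual_solution_inner_ge[OF assms(1)] assms(2)]
  by (intro psi_leI) (simp add: inner_commute)

text \<open>A common descent direction \<open>d\<close> at \<open>p\<close> has slopes below some
  \<open>- c\<close> for all components near \<open>p\<close>. Every convex combination of the
  gradients inherits this slope, and Cauchy-Schwarz turns it into a norm bound. Quantifying over all
  weights avoids any continuity of the chosen dual solutions.\<close>

lemma norm_grad_comb_bounded_away:
  fixes F :: "real^'n \<Rightarrow> real^'m"
  assumes cont: "\<And>i. continuous_on UNIV (grad_comp F i)" and "\<not> Pareto_critical F p"
  obtains \<epsilon> where "0 < \<epsilon>"
    "\<forall>\<^sub>F y in nhds p. \<forall>l\<in>unit_simplex. \<epsilon> \<le> norm (grad_comb F y l)"
proof -
  obtain d where d: "\<And>i. grad_comp F i p \<bullet> d < 0"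
    using assms(2) by (auto simp: Pareto_critical_def)
  \<comment> \<open>Halving the worst slope makes the bound by \<open>- c\<close> strict at
    \<open>p\<close>, so that it persists in a neighbourhood.\<close>
  define c where "c = - psi F p d / 2"
  have "psi F p d < 0"
    unfolding psi_def using d by (subst Max_less_iff) auto
  then have c: "0 < c" and lt: "grad_comp F i p \<bullet> d < - c" for i
    using grad_comp_le_psi[of F i p d] by (auto simp: c_def)
  have d0: "d \<noteq> 0"
    using d by force
  have "\<forall>\<^sub>F y in nhds p. grad_comp F i y \<bullet> d < - c" for i
  proof -
    have "isCont (grad_comp F i) p"
      using cont by (simp add: continuous_on_eq_continuous_at)
    then have "((\<lambda>y. grad_comp F i y \<bullet> d) \<longlongrightarrow> grad_comp F i p \<bullet> d) (nhds p)"
      by (intro tendsto_intros) (simp add: tendsto_nhds_iff isCont_def)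
    from order_tendstoD(2)[OF this lt] show ?thesis .
  qed
  then have "\<forall>\<^sub>F y in nhds p. \<forall>i. grad_comp F i y \<bullet> d < - c"
    by (simp add: eventually_all_finite)
  then have "\<forall>\<^sub>F y in nhds p. \<forall>l\<in>unit_simplex. c / norm d \<le> norm (grad_comb F y l)"
  proof (rule eventually_mono, intro ballI)
    fix y l assume lt: "\<forall>i. grad_comp F i y \<bullet> d < - c" and "l \<in> (unit_simplex :: (real^'m) set)"
    then have l: "\<And>i. 0 \<le> l $ i" "(\<Sum>i\<in>UNIV. l $ i) = 1"
      by (auto simp: unit_simplex_def)
    have "grad_comb F y l \<bullet> d = (\<Sum>i\<in>UNIV. l $ i * (grad_comp F i y \<bullet> d))"
      by (simp add: grad_comb_def inner_sum_left)
    also have "\<dots> \<le> (\<Sum>i\<in>UNIV. l $ i * (- c))"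
      using l(1) lt by (intro sum_mono mult_left_mono) (auto intro: less_imp_le)
    also have "\<dots> = - c"
      using l(2) by (simp flip: sum_distrib_right add: sum_negf)
    finally have "c \<le> norm (grad_comb F y l) * norm d"
      using Cauchy_Schwarz_ineq2[of "grad_comb F y l" d] by linarith
    then show "c / norm d \<le> norm (grad_comb F y l)"
      using d0 by (simp add: divide_le_eq)
  qed
  with c d0 show ?thesis
    by (intro that[of "c / norm d"]) auto
qed

text \<open>Rejection forces a slope above \<open>\<rho> * psi F x d\<close> at some intermediate
  point, while the slope at \<open>x\<close> is at most \<open>psi F x d\<close>. The difference
  exceeds \<open>(1 - \<rho>) * c * (norm w)^2\<close> with \<open>w = grad_comb F x l\<close>, and
  Cauchy-Schwarz bounds it by the gradient difference times
  \<open>norm d = c * norm w\<close>.\<close>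

lemma armijo_rejected_gradient_gap:
  assumes C1: "continuously_differentiable F" and dual: "dual_solution F x l"
    and "0 < c" "0 < a" "\<rho> < 1"
    and d: "d = c *\<^sub>R (- grad_comb F x l)"
    and rej: "F x $ i + \<rho> * a * psi F x d < F (x + a *\<^sub>R d) $ i"
  obtains \<xi> where "\<xi> \<in> closed_segment x (x + a *\<^sub>R d)"
    "(1 - \<rho>) * norm (grad_comb F x l) < norm (grad_comp F i \<xi> - grad_comp F i x)"
proof -
  let ?w = "grad_comb F x l" and ?g = "grad_comp F i"
  obtain \<xi> where \<xi>: "\<xi> \<in> closed_segment x (x + a *\<^sub>R d)"
    and mv: "F (x + a *\<^sub>R d) $ i - F x $ i = ?g \<xi> \<bullet> (a *\<^sub>R d)"
    by (rule gderiv_mvt[OF continuously_differentiable_grad_comp(1)[OF C1]])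
  have "a * (\<rho> * psi F x d) < a * (?g \<xi> \<bullet> d)"
    using rej mv by (simp add: algebra_simps)
  then have "\<rho> * psi F x d < ?g \<xi> \<bullet> d"
    using \<open>0 < a\<close> by simp
  then have "(1 - \<rho>) * - psi F x d < (?g \<xi> - ?g x) \<bullet> d"
    using grad_comp_le_psi[of F i x d] by (simp add: algebra_simps inner_diff_left)
  moreover have "(1 - \<rho>) * (c * (norm ?w)\<^sup>2) \<le> (1 - \<rho>) * - psi F x d"
    using psi_descent_le[OF dual, of c] \<open>0 < c\<close> \<open>\<rho> < 1\<close> unfolding d
    by (intro mult_left_mono) auto
  moreover have "(?g \<xi> - ?g x) \<bullet> d \<le> norm (?g \<xi> - ?g x) * (c * norm ?w)"
    using norm_cauchy_schwarz[of "?g \<xi> - ?g x" d] \<open>0 < c\<close> by (simp add: d)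
  ultimately have "(c * norm ?w) * ((1 - \<rho>) * norm ?w) < (c * norm ?w) * norm (?g \<xi> - ?g x)"
    by (simp add: power2_eq_square algebra_simps)
  \<comment> \<open>The strict inequality itself forces \<open>c * norm ?w\<close> to be positive,
    so this factor cancels.\<close>
  then have "(1 - \<rho>) * norm ?w < norm (?g \<xi> - ?g x)"
    using \<open>0 < c\<close> by (simp add: mult_less_cancel_left)
  with \<xi> show ?thesis by (rule that)
qed

theorem mainTheorem3:
  fixes F :: "real^'n \<Rightarrow> real^'m"
    and x0 :: "real^'n"
    and \<rho> \<delta> b :: real
    and B :: "(real^'n) set"
    and L :: "'m \<Rightarrow> real"
    and x :: "nat \<Rightarrow> real^'n"
    and lam :: "nat \<Rightarrow> real^'m"
    and t \<tau> :: "nat \<Rightarrow> real"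
  assumes C1: "continuously_differentiable F"
    and rho: "0 < \<rho>" "\<rho> < 1"
    and delta: "0 < \<delta>" "\<delta> < 1"
    and A1: "\<And>i. bdd_below ((\<lambda>y. F y $ i) ` level_set F x0)"
    and A2: "open B" "level_set F x0 \<subseteq> B"
      "\<And>i. 0 < L i"
      "\<And>i y z. y \<in> B \<Longrightarrow> z \<in> B \<Longrightarrow>
         norm (grad_comp F i y - grad_comp F i z) \<le> L i * norm (y - z)"
    and alg: "MSD_I F \<rho> \<delta> x0 x lam t \<tau>"
    and tau_pos: "\<And>k. 0 < \<tau> k"
    and A3: "0 < b" "\<And>k. \<tau> k \<le> b"
  shows "\<forall>p. seq_limit_point x p \<longrightarrow> Pareto_critical F p"
proof (intro allI impI, rule ccontr)
  fix p assume "seq_limit_point x p" and not_crit: "\<not> Pareto_critical F p"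
  then obtain r where r: "strict_mono r" and lim: "(\<lambda>k. x (r k)) \<longlonglongrightarrow> p"
    by (auto simp: seq_limit_point_def o_def)
  note grad = continuously_differentiable_grad_comp[OF C1]
  \<comment> \<open>The sign is opposite to the descent direction: \<open>w k\<close> stands for
    -v(x^k), and the update reads \<open>x (Suc k) = x k - s k * w k\<close>.\<close>
  define w where "w k = grad_comb F (x k) (lam k)" for k
  define d where "d k = inverse (\<tau> k) *\<^sub>R (- w k)" for k
  define s where "s k = t k / \<tau> k" for k
  have dual: "dual_solution F (x k) (lam k)" and w0: "w k \<noteq> 0"
    and tS: "t k \<in> armijo_steps F \<rho> \<delta> (x k) (d k)"
    and tmax: "\<And>a. a \<in> armijo_steps F \<rho> \<delta> (x k) (d k) \<Longrightarrow> a \<le> t k"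
    and step: "x (Suc k) = x k + t k *\<^sub>R d k" for k
    using alg by (auto simp: MSD_I_def Let_def w_def d_def)
  have simplex: "lam k \<in> unit_simplex" for k
    using dual[of k] by (simp add: dual_solution_def is_arg_min_def)
  have t_pos: "0 < t k" for k
    using tS[of k] delta by (auto simp: armijo_steps_def)
  have s_pos: "0 < s k" for k
    using t_pos tau_pos by (simp add: s_def)

  \<comment> \<open>Sufficient decrease and its limit along the subsequence\<close>
  have decr: "\<rho> * (s k * (norm (w k))\<^sup>2) \<le> F (x k) $ i - F (x (Suc k)) $ i" for k i
  proof -
    have "\<rho> * t k * psi F (x k) (d k) \<le> \<rho> * t k * - (inverse (\<tau> k) * (norm (w k))\<^sup>2)"
      using psi_descent_le[OF dual[of k], of "inverse (\<tau> k)"] rho t_pos[of k] tau_pos[of k]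
      unfolding d_def w_def by (intro mult_left_mono) auto
    moreover have "F (x (Suc k)) $ i \<le> F (x k) $ i + \<rho> * t k * psi F (x k) (d k)"
      using tS[of k] by (simp add: armijo_steps_def step)
    ultimately show ?thesis
      by (simp add: s_def divide_inverse)
  qed
  have mono: "decseq (\<lambda>k. F (x k) $ i)" for i
  proof (rule decseq_SucI)
    fix k
    have "0 \<le> \<rho> * (s k * (norm (w k))\<^sup>2)"
      using rho s_pos[of k] by simp
    with decr[of k i] show "F (x (Suc k)) $ i \<le> F (x k) $ i" by linarith
  qed

  have sw2: "(\<lambda>k. s (r k) * (norm (w (r k)))\<^sup>2) \<longlonglongrightarrow> 0"
  proof -
    \<comment> \<open>Any single objective will do, and the index type is nonempty. Its values
      converge along the subsequence by continuity at \<open>p\<close>, so the drops between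
      successive members vanish.\<close>
    obtain i :: 'm where True by simp
    have "isCont (\<lambda>y. F y $ i) p"
      using grad(1) unfolding gderiv_def by (rule has_derivative_continuous)
    then have Flim: "(\<lambda>k. F (x (r k)) $ i) \<longlonglongrightarrow> F p $ i"
      by (rule isCont_tendsto_compose) (rule lim)
    have "(\<lambda>k. (F (x (r k)) $ i - F (x (r (Suc k))) $ i) / \<rho>) \<longlonglongrightarrow> (F p $ i - F p $ i) / \<rho>"
      using rho by (intro tendsto_intros Flim LIMSEQ_Suc[OF Flim]) auto
    then have upper: "(\<lambda>k. (F (x (r k)) $ i - F (x (r (Suc k))) $ i) / \<rho>) \<longlonglongrightarrow> 0"
      by simp
    have le: "s (r k) * (norm (w (r k)))\<^sup>2 \<le> (F (x (r k)) $ i - F (x (r (Suc k))) $ i) / \<rho>" for k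
    proof -
      \<comment> \<open>The subsequence may skip iterates; monotonicity bounds the drop of the one
        step after \<open>r k\<close> by the drop up to \<open>r (Suc k)\<close>.\<close>
      have "Suc (r k) \<le> r (Suc k)"
        using r by (simp add: Suc_leI strict_mono_less)
      from decseqD[OF mono this, of i] decr[of "r k" i] rho show ?thesis
        by (simp add: field_simps)
    qed
    have ge: "0 \<le> s (r k) * (norm (w (r k)))\<^sup>2" for k
      using s_pos[of "r k"] by simp
    show ?thesis
      by (rule real_tendsto_sandwich[OF always_eventually always_eventually tendsto_const upper])
        (use le ge in blast)+
  qed

  \<comment> \<open>Uniform estimates near the non-critical limit point\<close>
  obtain \<epsilon> where \<epsilon>: "0 < \<epsilon>"
    and away: "\<forall>\<^sub>F y in nhds p. \<forall>l\<in>unit_simplex. \<epsilon> \<le> norm (grad_comb F y l)"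
    using norm_grad_comb_bounded_away[OF grad(2) not_crit] by blast
  have w_ge: "\<forall>\<^sub>F k in sequentially. \<epsilon> \<le> norm (w (r k))"
    using eventually_compose_filterlim[OF away lim]
    by (rule eventually_mono) (use simplex in \<open>auto simp: w_def\<close>)

  \<comment> \<open>Two gradients within \<open>\<eta>\<close> of the gradient at \<open>p\<close>
    differ by less than \<open>2 * \<eta> = (1 - \<rho>) * \<epsilon>\<close>, which is what
    contradicts the gap from a rejected step.\<close>
  define \<eta> where "\<eta> = (1 - \<rho>) * \<epsilon> / 2"
  have "0 < \<eta>"
    using rho \<epsilon> by (simp add: \<eta>_def)
  have "\<forall>\<^sub>F y in nhds p. \<forall>i. dist (grad_comp F i y) (grad_comp F i p) < \<eta>"
  proof -
    have "isCont (grad_comp F i) p" for i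
      using grad(2) by (simp add: continuous_on_eq_continuous_at)
    then have "\<forall>\<^sub>F y in nhds p. dist (grad_comp F i y) (grad_comp F i p) < \<eta>" for i
      using \<open>0 < \<eta>\<close> by (intro tendstoD) (auto simp: tendsto_nhds_iff isCont_def)
    then show ?thesis
      by (simp add: eventually_all_finite)
  qed
  then obtain R where R: "0 < R"
    and near: "\<And>y i. y \<in> ball p R \<Longrightarrow> dist (grad_comp F i y) (grad_comp F i p) < \<eta>"
    unfolding eventually_nhds_metric by (auto simp: dist_commute)

  \<comment> \<open>The first entry will force \<open>s k * b < 1\<close>, hence
    \<open>t k < 1\<close>; the second will force the rejected trial step to be shorter than
    \<open>R / 2\<close>. One index satisfying all bounds is enough.\<close>
  define \<kappa> where "\<kappa> = min (\<epsilon>\<^sup>2 / b) (\<epsilon> * (\<delta> * R / 2))"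
  have "0 < \<kappa>"
    using \<epsilon> A3(1) delta R by (simp add: \<kappa>_def)
  from order_tendstoD(2)[OF sw2 this] w_ge tendstoD[OF lim, of "R / 2"] R
  have "\<forall>\<^sub>F k in sequentially. s (r k) * (norm (w (r k)))\<^sup>2 < \<kappa> \<and> \<epsilon> \<le> norm (w (r k))
      \<and> dist (x (r k)) p < R / 2"
    by (intro eventually_conj) auto
  then obtain n where "s (r n) * (norm (w (r n)))\<^sup>2 < \<kappa>" "\<epsilon> \<le> norm (w (r n))"
    "dist (x (r n)) p < R / 2"
    by (auto dest: eventually_happens)
  then obtain k where sw: "s k * (norm (w k))\<^sup>2 < \<kappa>" and wk: "\<epsilon> \<le> norm (w k)"
    and xk: "dist (x k) p < R / 2"
    by blast

  \<comment> \<open>The last rejected trial step and the contradiction\<close>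
  have "s k * \<epsilon>\<^sup>2 \<le> s k * (norm (w k))\<^sup>2"
    using \<epsilon> wk s_pos[of k] by (intro mult_left_mono power_mono) auto
  also have "\<dots> < \<epsilon>\<^sup>2 / b"
    using sw by (simp add: \<kappa>_def)
  finally have "s k * b < 1"
    using \<epsilon> A3(1) by (simp add: field_simps)
  moreover have "s k * \<tau> k \<le> s k * b"
    using A3(2)[of k] s_pos[of k] by (intro mult_left_mono) auto
  moreover have "s k * \<tau> k = t k"
    using tau_pos[of k] by (simp add: s_def)
  ultimately have "t k < 1" by linarith
  moreover obtain j where j: "t k = \<delta> ^ j"
    using tS[of k] by (auto simp: armijo_steps_def)
  \<comment> \<open>Since \<open>t k < 1\<close> excludes exponent 0, the preceding power
    \<open>a = t k / \<delta>\<close> is also a trial step. It is larger than \<open>t k\<close>, so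
    maximality of \<open>t k\<close> means that it failed for some component.\<close>
  ultimately obtain j' where "j = Suc j'"
    by (cases j) auto
  define a where "a = \<delta> ^ j'"
  have ta: "t k = \<delta> * a"
    by (simp add: a_def j \<open>j = Suc j'\<close>)
  have "0 < a"
    using delta by (simp add: a_def)
  then have "t k < a"
    using delta by (simp add: ta)
  then have "a \<notin> armijo_steps F \<rho> \<delta> (x k) (d k)"
    using tmax[of a k] by force
  then obtain i where "F (x k) $ i + \<rho> * a * psi F (x k) (d k) < F (x k + a *\<^sub>R d k) $ i"
    unfolding armijo_steps_def a_def by (auto simp: not_le)
  then obtain \<xi> where \<xi>: "\<xi> \<in> closed_segment (x k) (x k + a *\<^sub>R d k)"
    and gap: "(1 - \<rho>) * norm (w k) < norm (grad_comp F i \<xi> - grad_comp F i (x k))"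
    using armijo_rejected_gradient_gap[OF C1 dual[of k], of "inverse (\<tau> k)" a \<rho> "d k" i]
      tau_pos[of k] \<open>0 < a\<close> rho unfolding d_def w_def by auto

  have "\<epsilon> * (s k * norm (w k)) \<le> s k * (norm (w k))\<^sup>2"
    using mult_right_mono[OF wk, of "s k * norm (w k)"] s_pos[of k]
    by (simp add: power2_eq_square algebra_simps)
  also have "\<dots> < \<epsilon> * (\<delta> * R / 2)"
    using sw by (simp add: \<kappa>_def)
  finally have "s k * norm (w k) < \<delta> * R / 2"
    using \<epsilon> by (simp only: mult_less_cancel_left_pos)
  \<comment> \<open>The rejected displacement is longer than the accepted one by the factor
    \<open>1 / \<delta>\<close>, which the \<open>\<delta>\<close> in \<open>\<kappa>\<close>
    compensates.\<close>
  moreover have "s k * norm (w k) = \<delta> * norm (a *\<^sub>R d k)"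
    using tau_pos[of k] \<open>0 < a\<close> by (simp add: s_def d_def ta field_simps)
  ultimately have "\<delta> * norm (a *\<^sub>R d k) < \<delta> * (R / 2)"
    by simp
  then have "norm (a *\<^sub>R d k) < R / 2"
    using delta by (simp only: mult_less_cancel_left_pos)
  then have "dist (x k) (x k + a *\<^sub>R d k) < R / 2"
    by (simp add: dist_norm)
  then have "x k + a *\<^sub>R d k \<in> ball p R"
    using xk dist_triangle[of p "x k + a *\<^sub>R d k" "x k"] by (simp add: dist_commute)
  moreover have xk_ball: "x k \<in> ball p R"
    using xk R by (simp add: dist_commute)
  \<comment> \<open>Both ends of the segment lie in the ball, so convexity places the mean value
    point there too.\<close>
  ultimately have "\<xi> \<in> ball p R"
    using \<xi> closed_segment_subset[OF _ _ convex_ball] by blast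
  with near[of \<xi> i] near[OF xk_ball, of i]
  have "dist (grad_comp F i \<xi>) (grad_comp F i (x k)) < 2 * \<eta>"
    using dist_triangle2[of "grad_comp F i \<xi>" "grad_comp F i (x k)" "grad_comp F i p"] by linarith
  also have "\<dots> \<le> (1 - \<rho>) * norm (w k)"
    using wk rho by (simp add: \<eta>_def)
  finally show False
    using gap by (simp add: dist_norm)
qed

end
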